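(* Let $G=(V,A)$ be a two-way directed graph with centroid set $B\subseteq V$ and turning factors $\alpha$, let $M\subseteq V$ be a set of monitored vertices, and let $G'_i$ be any unmonitored component, with associated block $\mathbf{F}^i$ of the flow calculation matrix. Let $C_i$ be a minimum vertex cut between $(B-M)_i$ and $A(M)_i$ in $G'_i$ (with $C_i=\varnothing$ if $(B-M)_i$ is empty). If $\operatorname{rank}(\mathbf{F}^i)$ equals the number of columns of $\mathbf{F}^i$, then $|C_i|=|(B-M)_i|$.
   Context: A two-way directed graph is a finite directed graph $G=(V,A)$ without loops or parallel arcs such that $uv\in A$ implies $vu\in A$. Every vertex is assumed to have at least one outgoing arc. $B\subseteq V$ is the set of centroids and $M\subseteq V$ the set of monitored vertices. Turning factors: each arc $vu$ has a positive turning ratio $c_{vu}$. For each vertex $v$ a canonical outgoing arc $e_v=vw$ is fixed, and $\alpha_{vu}=c_{vu}/c_{vw}>0$ for every outgoing arc $vu$ of $v$. $A(M)$ is the set of vertices in $V\setminus M$ adjacent to at least one vertex of $M$. The combined cutset $C_M$ is the set of arcs of the subgraph of $G$ induced by $M\cup A(M)$. The unmonitored subgraph is $G'=(V\setminus M, A\setminus C_M)$; its connected components $G'_1,G'_2,\dots$ are the unmonitored components. For each $i$, $(B-M)_i$ and $A(M)_i$ denote the sets of vertices of $G'_i$ lying in $B\setminus M$ and in $A(M)$, respectively. Flow calculation matrix $\mathbf{F}$: its rows are indexed by $V\setminus M$. Its columns are of two kinds: one "canonical arc" column for each $v\in V\setminus(M\cup A(M))$, and one "balancing flow" column for each $b\in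 B\setminus M$. The entry in row $u$ and canonical arc column $v$ is $\alpha_{vu}$ if $vu\in A$, is $-\sum_{w:\,vw\in A}\alpha_{vw}$ if $u=v$ (the sum being over all neighbors of $v$ in $G$), and is $0$ otherwise. The entry in row $u$ and balancing flow column $b$ is $1$ if $u=b$ and $0$ otherwise. The block $\mathbf{F}^i$ is the submatrix with rows indexed by the vertices of $G'_i$ and columns corresponding to the vertices of $G'_i$ (canonical arc columns for vertices of $G'_i$ not in $A(M)$, balancing flow columns for vertices in $(B-M)_i$). The flow on $G'_i$ is called calculable when $\mathbf{F}^i$ has full column rank. A vertex cut between vertex sets $X$ and $Y$ in $G'_i$ is a set of vertices of $G'_i$ (possibly including vertices of $X\cup Y$) meeting every path of $G'_i$ from $X$ to $Y$, including one-vertex paths; minimum means of minimum cardinality. *)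

theory Defs
  imports "Jordan_Normal_Form.DL_Rank" "Graph_Theory.Graph_Theory"
begin

text \<open>
  A two-way directed graph is a \<^locale>\<open>pair_graph\<close>: finite, loop-free, arcs are pairs of
  vertices (so there are no parallel arcs), and the arc relation is symmetric.
\<close>

locale flow_network = pair_graph G
  for G :: "'a pair_pre_digraph" +
  fixes B :: "'a set"  \<comment> \<open>centroids\<close>
    and M :: "'a set"  \<comment> \<open>monitored vertices\<close>
    and c :: "'a \<times> 'a \<Rightarrow> real"  \<comment> \<open>turning ratios\<close>
    and e :: "'a \<Rightarrow> 'a \<times> 'a"  \<comment> \<open>canonical outgoing arcs\<close>
  assumes out_arcs_nonempty: "v \<in> pverts G \<Longrightarrow> out_arcs (with_proj G) v \<noteq> {}"
    and centroids_subset: "B \<subseteq> pverts G"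
    and monitored_subset: "M \<subseteq> pverts G"
    and ratio_pos: "a \<in> parcs G \<Longrightarrow> c a > 0"
    and canonical_arc: "v \<in> pverts G \<Longrightarrow> e v \<in> out_arcs (with_proj G) v"

definition turning_factor :: "('a \<times> 'a \<Rightarrow> real) \<Rightarrow> ('a \<Rightarrow> 'a \<times> 'a) \<Rightarrow> 'a \<Rightarrow> 'a \<Rightarrow> real" where
  "turning_factor c e v u = c (v, u) / c (e v)"

definition adj_monitored :: "'a pair_pre_digraph \<Rightarrow> 'a set \<Rightarrow> 'a set" where
  "adj_monitored G M = {v \<in> pverts G - M. \<exists>m\<in>M. (v, m) \<in> parcs G}"

definition combined_cutset :: "'a pair_pre_digraph \<Rightarrow> 'a set \<Rightarrow> ('a \<times> 'a) set" where
  "combined_cutset G M = arcs (with_proj G \<restriction> (M \<union> adj_monitored G M))"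

text \<open>Arcs joining two vertices of \<^term>\<open>adj_monitored G M\<close> are deleted as well, so this is in
  general not the subgraph induced by the unmonitored vertices.\<close>

definition unmonitored_subgraph :: "'a pair_pre_digraph \<Rightarrow> 'a set \<Rightarrow> 'a pair_pre_digraph" where
  "unmonitored_subgraph G M =
     \<lparr>pverts = pverts G - M, parcs = parcs G - combined_cutset G M\<rparr>"

definition unmonitored_component ::
    "'a pair_pre_digraph \<Rightarrow> 'a set \<Rightarrow> ('a, 'a \<times> 'a) pre_digraph \<Rightarrow> bool" where
  "unmonitored_component G M H \<longleftrightarrow>
     pre_digraph.max_subgraph (with_proj (unmonitored_subgraph G M)) Digraph_Component.connected H"

datatype 'a flow_column =
    Canonical_Arc (column_vertex: 'a)
  | Balancing_Flow (column_vertex: 'a)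

definition flow_columns ::
    "'a pair_pre_digraph \<Rightarrow> 'a set \<Rightarrow> 'a set \<Rightarrow> 'a flow_column set" where
  "flow_columns G B M =
     Canonical_Arc ` (pverts G - (M \<union> adj_monitored G M)) \<union> Balancing_Flow ` (B - M)"

fun flow_entry ::
    "'a pair_pre_digraph \<Rightarrow> ('a \<times> 'a \<Rightarrow> real) \<Rightarrow> ('a \<Rightarrow> 'a \<times> 'a) \<Rightarrow>
     'a \<Rightarrow> 'a flow_column \<Rightarrow> real" where
  "flow_entry G c e u (Canonical_Arc v) =
     (if (v, u) \<in> parcs G then turning_factor c e v u
      else if u = v then - (\<Sum>w | (v, w) \<in> parcs G. turning_factor c e v w)
      else 0)"
| "flow_entry G c e u (Balancing_Flow b) = (if u = b then 1 else 0)"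

definition block_columns ::
    "'a pair_pre_digraph \<Rightarrow> 'a set \<Rightarrow> 'a set \<Rightarrow> ('a, 'a \<times> 'a) pre_digraph \<Rightarrow> 'a flow_column set" where
  "block_columns G B M H = {k \<in> flow_columns G B M. column_vertex k \<in> verts H}"

text \<open>
  The rows and columns of the flow calculation matrix are indexed by vertices and flows, whereas
  \<^typ>\<open>real mat\<close> is indexed by natural numbers. The lists \<^term>\<open>rs\<close> and \<^term>\<open>cs\<close> order the
  row and the column indices.
\<close>

definition flow_matrix ::
    "'a pair_pre_digraph \<Rightarrow> ('a \<times> 'a \<Rightarrow> real) \<Rightarrow> ('a \<Rightarrow> 'a \<times> 'a) \<Rightarrow>
     'a list \<Rightarrow> 'a flow_column list \<Rightarrow> real mat" where
  "flow_matrix G c e rs cs =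
     mat (length rs) (length cs) (\<lambda>(i, j). flow_entry G c e (rs ! i) (cs ! j))"

definition is_flow_block ::
    "'a pair_pre_digraph \<Rightarrow> 'a set \<Rightarrow> 'a set \<Rightarrow> ('a \<times> 'a \<Rightarrow> real) \<Rightarrow> ('a \<Rightarrow> 'a \<times> 'a) \<Rightarrow>
     ('a, 'a \<times> 'a) pre_digraph \<Rightarrow> real mat \<Rightarrow> bool" where
  "is_flow_block G B M c e H F \<longleftrightarrow>
     (\<exists>rs cs. distinct rs \<and> set rs = verts H \<and>
              distinct cs \<and> set cs = block_columns G B M H \<and>
              F = flow_matrix G c e rs cs)"

definition vertex_cut ::
    "('a, 'b) pre_digraph \<Rightarrow> 'a set \<Rightarrow> 'a set \<Rightarrow> 'a set \<Rightarrow> bool" where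
  "vertex_cut H X Y C \<longleftrightarrow>
     C \<subseteq> verts H \<and> (\<forall>p. vpath p H \<and> hd p \<in> X \<and> last p \<in> Y \<longrightarrow> set p \<inter> C \<noteq> {})"

definition minimum_vertex_cut ::
    "('a, 'b) pre_digraph \<Rightarrow> 'a set \<Rightarrow> 'a set \<Rightarrow> 'a set \<Rightarrow> bool" where
  "minimum_vertex_cut H X Y C \<longleftrightarrow> is_arg_min card (vertex_cut H X Y) C"

end

theory Submission
  imports Defs
begin

text \<open>
  Fix a vertex cut \<open>C\<close> and let \<open>S\<close> be the set of vertices that can be reached from \<open>(B - M)\<^sub>i\<close> by a
  path avoiding \<open>C\<close>. The set \<open>S\<close> contains no vertex adjacent to \<open>M\<close>, so each of its vertices has a
  canonical arc column, and all neighbours of vertices of \<open>S\<close> lie in \<open>S \<union> C\<close>. Hence the \<open>|S|\<close>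
  canonical arc columns of \<open>S\<close> and the \<open>|(B - M)\<^sub>i|\<close> balancing flow columns are supported on the rows
  \<open>S \<union> C\<close>. Linear independence gives \<open>|S| + |(B - M)\<^sub>i| \<le> |S| + |C|\<close>, while \<open>(B - M)\<^sub>i\<close> is itself a
  vertex cut.
\<close>

section \<open>Rank and supports of columns\<close>

text \<open>The rank is the size of a maximal independent subset of the set of columns, and a
  repeated column would make that set smaller than \<open>nc\<close>. This allows independence to be
  stated for a set of columns.\<close>

lemma (in vec_space) full_rank_distinct_cols:
  assumes A: "A \<in> carrier_mat n nc" and rank: "rank A = nc"
  shows "distinct (cols A)"
proof -
  obtain S where S: "maximal S (\<lambda>T. T \<subseteq> set (cols A) \<and> lin_indpt T)"
    using maximal_exists[of "(\<lambda>T. T \<subseteq> set (cols A) \<and> lin_indpt T)" "card (set (cols A))" "{}"]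
    by (meson List.finite_set card_mono empty_iff empty_subsetI finite_lin_indpt2 rev_finite_subset)
  then have "card S \<le> card (set (cols A))"
    by (simp add: card_mono maximal_def)
  with rank_card_indpt[OF A S] rank A have "length (cols A) \<le> card (set (cols A))"
    by simp
  then show ?thesis
    using card_length[of "cols A"] by (simp add: card_distinct)
qed

lemma (in vec_space) in_span_unit_vecs:
  assumes v: "v \<in> carrier_vec n" and I: "I \<subseteq> {..<n}"
    and zero: "\<And>i. i < n \<Longrightarrow> i \<notin> I \<Longrightarrow> v $ i = 0"
  shows "v \<in> span (unit_vec n ` I)"
proof -
  let ?U = "unit_vec n ` I"
  have fin: "finite I"
    using I finite_subset by blast
  have U: "?U \<subseteq> carrier_vec n"
    by auto
  have inj: "inj_on (unit_vec n :: nat \<Rightarrow> 'a vec) I"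
    using I by (auto simp: inj_on_def)
  have dim: "dim_vec (lincomb (\<lambda>u. u \<bullet> v) ?U) = n"
    using fin U by (intro lincomb_dim) auto
  \<comment> \<open>Coefficients are indexed by vectors, not by coordinates; the scalar product with
    \<open>unit_vec n k\<close> recovers the coordinate \<open>v $ k\<close>.\<close>
  have "v = lincomb (\<lambda>u. u \<bullet> v) ?U"
  proof (rule eq_vecI)
    show "dim_vec v = dim_vec (lincomb (\<lambda>u. u \<bullet> v) ?U)"
      using v dim by simp
    fix i assume "i < dim_vec (lincomb (\<lambda>u. u \<bullet> v) ?U)"
    then have i: "i < n"
      using dim by simp
    have "lincomb (\<lambda>u. u \<bullet> v) ?U $ i = (\<Sum>k\<in>I. (unit_vec n k \<bullet> v) * unit_vec n k $ i)"
      by (simp add: lincomb_index[OF i U] sum.reindex[OF inj])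
    also have "\<dots> = (\<Sum>k\<in>I. if k = i then v $ i else 0)"
      using I v i by (intro sum.cong) (auto simp: scalar_prod_left_unit)
    also have "\<dots> = v $ i"
      using fin zero[OF i] by simp
    finally show "v $ i = lincomb (\<lambda>u. u \<bullet> v) ?U $ i" ..
  qed
  then show ?thesis
    using finite_span[OF finite_imageI[OF fin] U] by (auto simp: class_field_def)
qed

text \<open>The columns in \<open>J\<close> are independent and lie in the span of the unit vectors
  of \<open>I\<close>, so the exchange lemma bounds their number.\<close>

lemma (in vec_space) full_rank_card_support:
  assumes A: "A \<in> carrier_mat n nc" and rank: "rank A = nc"
    and J: "J \<subseteq> {..<nc}" and I: "I \<subseteq> {..<n}"
    and supp: "\<And>i j. i < n \<Longrightarrow> j \<in> J \<Longrightarrow> A $$ (i, j) \<noteq> 0 \<Longrightarrow> i \<in> I"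
  shows "card J \<le> card I"
proof -
  have dist: "distinct (cols A)"
    using full_rank_distinct_cols[OF A rank] .
  let ?X = "col A ` J" and ?U = "unit_vec n ` I :: 'a vec set"
  have finI: "finite I"
    using I finite_subset by blast
  have finJ: "finite J"
    using J finite_subset by blast
  \<comment> \<open>Without repeated columns, passing from indices to the set \<open>?X\<close>
    loses nothing in the count.\<close>
  have "inj_on (col A) J"
    using dist A J unfolding inj_on_def by (auto simp: distinct_conv_nth subset_iff)
  then have cX: "card ?X = card J"
    by (rule card_image)
  have "?X \<subseteq> set (cols A)"
    using A J by (auto simp: cols_def)
  then have li: "lin_indpt ?X"
    using full_rank_lin_indpt[OF A rank dist] subset_li_is_li by blast
  have XU: "?X \<subseteq> span ?U"
  proof
    fix x assume "x \<in> ?X"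
    then obtain j where j: "j \<in> J" "x = col A j"
      by auto
    with J have "j < nc"
      by auto
    with A j supp[OF _ j(1)] show "x \<in> span ?U"
      by (intro in_span_unit_vecs[OF _ I]) auto
  qed
  have U: "?U \<subseteq> carrier_vec n"
    by auto
  have "card ?X \<le> card ?U"
    using replacement[OF finite_imageI[OF finJ] finite_imageI[OF finI] U li XU] by force
  also have "\<dots> \<le> card I"
    by (rule card_image_le[OF finI])
  finally show ?thesis
    unfolding cX .
qed

lemma card_indices_nth_in:
  assumes "distinct xs" "T \<subseteq> set xs"
  shows "card {i. i < length xs \<and> xs ! i \<in> T} = card T"
proof -
  have "(!) xs ` {i. i < length xs \<and> xs ! i \<in> T} = T"
    using assms(2) by (auto simp: in_set_conv_nth subset_iff image_iff)
  moreover have "inj_on ((!) xs) {i. i < length xs \<and> xs ! i \<in> T}"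
    using assms(1) by (auto simp: inj_on_def nth_eq_iff_index_eq)
  ultimately show ?thesis
    using card_image by fastforce
qed

text \<open>Transfers the bound from positions in the lists to vertices and flows, so that the
  chosen orderings disappear from the argument.\<close>

lemma full_rank_flow_matrix_card_support:
  assumes rs: "distinct rs" and cs: "distinct cs"
    and rank: "vec_space.rank (length rs) (flow_matrix G c e rs cs) = length cs"
    and R: "R \<subseteq> set rs" and K: "K \<subseteq> set cs"
    and supp: "\<And>u k. u \<in> set rs \<Longrightarrow> k \<in> K \<Longrightarrow> flow_entry G c e u k \<noteq> 0 \<Longrightarrow> u \<in> R"
  shows "card K \<le> card R"
proof -
  let ?J = "{j. j < length cs \<and> cs ! j \<in> K}" and ?I = "{i. i < length rs \<and> rs ! i \<in> R}"
  have "card ?J \<le> card ?I"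
  proof (rule vec_space.full_rank_card_support[OF _ rank])
    show "flow_matrix G c e rs cs \<in> carrier_mat (length rs) (length cs)"
      by (simp add: flow_matrix_def)
    show "i \<in> ?I" if "i < length rs" "j \<in> ?J" "flow_matrix G c e rs cs $$ (i, j) \<noteq> 0" for i j
      using that supp[of "rs ! i" "cs ! j"] by (simp add: flow_matrix_def)
  qed auto
  then show ?thesis
    by (simp add: card_indices_nth_in rs cs R K)
qed

section \<open>Maximal connected subgraphs are closed under arcs\<close>

text \<open>All vertices are joined through the tail of \<open>a\<close>: old ones inside
  \<open>H\<close>, the head along \<open>a\<close>, which counts in both directions because
  connectedness uses the symmetric closure.\<close>

lemma connected_insert_arc:
  assumes conn: "Digraph_Component.connected H"
    and sub: "subgraph H H'" and a: "a \<in> arcs H'" "tail H' a \<in> verts H"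
    and verts: "verts H' = insert (head H' a) (verts H)"
  shows "Digraph_Component.connected H'"
proof -
  let ?r = "rtrancl_on (verts H') ((arcs_ends H')\<^sup>s)"
  let ?t = "tail H' a" and ?h = "head H' a"
  have "arcs_ends H \<subseteq> arcs_ends H'"
    using sub by (rule arcs_ends_mono)
  then have mono: "(arcs_ends H)\<^sup>s \<subseteq> (arcs_ends H')\<^sup>s"
    by (auto simp: symcl_def)
  have old: "(u, v) \<in> ?r" if "u \<in> verts H" "v \<in> verts H" for u v
  proof (rule rtrancl_on_mono[OF mono])
    show "verts H \<subseteq> verts H'"
      using verts by auto
    show "(u, v) \<in> rtrancl_on (verts H) ((arcs_ends H)\<^sup>s)"
      using conn that unfolding connected_conv by simp
  qed
  have ends: "(?t, ?h) \<in> (arcs_ends H')\<^sup>s" "(?h, ?t) \<in> (arcs_ends H')\<^sup>s"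
    using a(1) by (auto simp: symcl_def arcs_ends_conv)
  have th: "(?t, ?h) \<in> ?r" and ht: "(?h, ?t) \<in> ?r"
    using ends a verts by (auto intro: rtrancl_on_into_rtrancl_on rtrancl_on.intros)
  have "(u, v) \<in> ?r" if "u \<in> verts H'" "v \<in> verts H'" for u v
  proof -
    have "(u, ?t) \<in> ?r" "(?t, v) \<in> ?r"
      using that verts old a(2) th ht by auto
    then show ?thesis
      by (rule rtrancl_on_trans)
  qed
  then show ?thesis
    using verts unfolding connected_conv by auto
qed

text \<open>Adding \<open>a\<close> and its head to \<open>H\<close> gives a connected subgraph
  again, which by maximality is \<open>H\<close> itself.\<close>

lemma (in wf_digraph) max_connected_subgraph_arc_closed:
  assumes H: "max_subgraph Digraph_Component.connected H"
    and a: "a \<in> arcs G" "tail G a \<in> verts H"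
  shows "a \<in> arcs H"
proof -
  define H' where "H' = \<lparr>verts = insert (head G a) (verts H), arcs = insert a (arcs H),
    tail = tail G, head = head G\<rparr>"
  have HG: "subgraph H G" and conn: "Digraph_Component.connected H"
    using H by (auto simp: max_subgraph_def)
  then have comp: "tail H = tail G" "head H = head G" and wfH: "wf_digraph H"
    by (auto simp: subgraph_def compatible_def)
  have wf': "wf_digraph H'"
    using wf_digraph.tail_in_verts[OF wfH] wf_digraph.head_in_verts[OF wfH] a
    by unfold_locales (auto simp: H'_def comp)
  have sub: "subgraph H H'"
    using wfH wf' by (auto simp: subgraph_def compatible_def H'_def comp)
  have "subgraph H' G"
    using HG wf' a head_in_verts[OF a(1)] by (simp add: subgraph_def compatible_def H'_def)
  moreover have "Digraph_Component.connected H'"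
    using connected_insert_arc[OF conn sub, of a] a by (auto simp: H'_def)
  ultimately have "H' = H"
    using H sub by (auto simp: max_subgraph_def)
  moreover have "a \<in> arcs H'"
    by (simp add: H'_def)
  ultimately show ?thesis
    by simp
qed

section \<open>The source side of a vertex cut\<close>

text \<open>Walks replace paths here because a walk can be extended by an arc without checking for
  repeated vertices.\<close>

definition avoiding_reach :: "('a, 'b) pre_digraph \<Rightarrow> 'a set \<Rightarrow> 'a set \<Rightarrow> 'a set" where
  "avoiding_reach H X C = {last p | p. vwalk p H \<and> hd p \<in> X \<and> set p \<inter> C = {}}"

lemma avoiding_reach_subset: "avoiding_reach H X C \<subseteq> verts H - C"
proof
  fix v assume "v \<in> avoiding_reach H X C"
  then obtain p where p: "vwalk p H" "set p \<inter> C = {}" "v = last p"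
    unfolding avoiding_reach_def by auto
  then have "v \<in> set p" "set p \<subseteq> verts H"
    by (auto simp: vwalk_def)
  with p(2) show "v \<in> verts H - C"
    by auto
qed

lemma avoiding_reach_source:
  "x \<in> X \<Longrightarrow> x \<in> verts H \<Longrightarrow> x \<notin> C \<Longrightarrow> x \<in> avoiding_reach H X C"
  unfolding avoiding_reach_def by (auto intro!: exI[of _ "[x]"])

lemma avoiding_reach_step:
  assumes v: "v \<in> avoiding_reach H X C" and vu: "(v, u) \<in> arcs_ends H"
    and u: "u \<in> verts H" "u \<notin> C"
  shows "u \<in> avoiding_reach H X C"
proof -
  from v obtain p where p: "vwalk p H" "hd p \<in> X" "set p \<inter> C = {}" "last p = v"
    unfolding avoiding_reach_def by auto
  then have "vwalk (p @ [u]) H"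
    using vu u by (auto simp: vwalk_def vwalk_arcs_append)
  moreover have "hd (p @ [u]) \<in> X"
    using p by (auto simp: vwalk_def)
  ultimately show ?thesis
    using p u unfolding avoiding_reach_def by (auto intro!: exI[of _ "p @ [u]"])
qed

lemma vertex_cut_avoiding_reach:
  assumes "vertex_cut H X Y C"
  shows "avoiding_reach H X C \<inter> Y = {}"
proof -
  have "last p \<notin> Y" if p: "vwalk p H" "hd p \<in> X" "set p \<inter> C = {}" for p
  proof
    \<comment> \<open>Cuts only speak of paths. Shortcutting the walk keeps both ends and adds no
      vertex, so the resulting path still avoids \<open>C\<close>.\<close>
    let ?q = "vwalk_to_vpath p"
    assume "last p \<in> Y"
    then have "set ?q \<inter> C \<noteq> {}"
      using assms p vwalk_to_vpath_vpath[OF p(1)]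
      by (simp add: vertex_cut_def vwalk_to_vpath_hd vwalk_to_vpath_last)
    then show False
      using p(3) vwalk_to_vpath_subset by fast
  qed
  then show ?thesis
    unfolding avoiding_reach_def by auto
qed

lemma vertex_cut_source:
  assumes "X \<subseteq> verts H"
  shows "vertex_cut H X Y X"
proof -
  have "hd p \<in> set p" if "vpath p H" for p
    using that by (simp add: vpath_def vwalk_def)
  then show ?thesis
    using assms unfolding vertex_cut_def by auto
qed

section \<open>Unmonitored components and the counting argument\<close>

context flow_network
begin

text \<open>An arc with an end in \<open>M\<close> has its other end in \<open>M\<close> or adjacent
  to \<open>M\<close>, so it belongs to the deleted cutset.\<close>

lemma unmonitored_subgraph_wf: "wf_digraph (with_proj (unmonitored_subgraph G M))"
proof
  fix a assume "a \<in> arcs (with_proj (unmonitored_subgraph G M))"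
  then have a: "a \<in> parcs G" "a \<notin> combined_cutset G M"
    by (auto simp: unmonitored_subgraph_def)
  \<comment> \<open>Adjacency to \<open>M\<close> is defined by arcs into \<open>M\<close>; the
    reversed arc handles the case of an arc leaving \<open>M\<close>.\<close>
  then have "fst a \<in> pverts G" "snd a \<in> pverts G" "(snd a, fst a) \<in> parcs G"
    using arcs_symmetric by (auto simp: in_arcsD1 in_arcsD2 prod_eq_iff)
  with a show "tail (with_proj (unmonitored_subgraph G M)) a \<in> verts (with_proj (unmonitored_subgraph G M))"
    "head (with_proj (unmonitored_subgraph G M)) a \<in> verts (with_proj (unmonitored_subgraph G M))"
    by (cases a; auto simp: unmonitored_subgraph_def combined_cutset_def adj_monitored_def)+
qed

text \<open>The tail \<open>v\<close> lies outside both \<open>M\<close> and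
  \<open>adj_monitored G M\<close>, so the arc is not in the cutset and survives the deletion;
  maximality of the component then captures it.\<close>

lemma unmonitored_component_arc_closed:
  assumes H: "unmonitored_component G M H" and v: "v \<in> verts H" "v \<notin> adj_monitored G M"
    and vu: "(v, u) \<in> parcs G"
  shows "(v, u) \<in> arcs_ends H" and "u \<in> verts H"
proof -
  let ?G' = "with_proj (unmonitored_subgraph G M)"
  interpret G': wf_digraph ?G'
    by (rule unmonitored_subgraph_wf)
  have sub: "subgraph H ?G'"
    using H by (auto simp: unmonitored_component_def pre_digraph.max_subgraph_def)
  then have "verts H \<subseteq> verts ?G'"
    by (rule subgraph_imp_subverts)
  with v vu have "(v, u) \<in> arcs ?G'"
    by (auto simp: unmonitored_subgraph_def combined_cutset_def)
  then have arc: "(v, u) \<in> arcs H"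
    using G'.max_connected_subgraph_arc_closed[of H "(v, u)"] H v
    by (simp add: unmonitored_component_def)
  have wfH: "wf_digraph H" and ht: "tail H = fst" "head H = snd"
    using sub by (auto simp: subgraph_def compatible_def)
  show "(v, u) \<in> arcs_ends H"
    using arc by (force simp: arcs_ends_conv ht)
  show "u \<in> verts H"
    using wf_digraph.head_in_verts[OF wfH arc] by (simp add: ht)
qed

lemma card_sources_le_card_vertex_cut:
  assumes H: "unmonitored_component G M H" and F: "is_flow_block G B M c e H F"
    and rank: "vec_space.rank (dim_row F) F = dim_col F"
    and cut: "vertex_cut H (verts H \<inter> (B - M)) (verts H \<inter> adj_monitored G M) C"
  shows "card (verts H \<inter> (B - M)) \<le> card C"
proof -
  let ?X = "verts H \<inter> (B - M)" and ?Y = "verts H \<inter> adj_monitored G M"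
  define S where "S = avoiding_reach H ?X C"
  have S: "S \<subseteq> verts H - C"
    unfolding S_def by (rule avoiding_reach_subset)
  have SY: "S \<inter> ?Y = {}"
    unfolding S_def using cut by (rule vertex_cut_avoiding_reach)
  have CH: "C \<subseteq> verts H"
    using cut by (simp add: vertex_cut_def)
  have sub: "verts H \<subseteq> pverts G - M"
    using H by (auto simp: unmonitored_component_def pre_digraph.max_subgraph_def
        subgraph_def unmonitored_subgraph_def)
  then have fin: "finite (verts H)"
    using finite_subset pair_finite_verts by blast
  from S CH fin have finS: "finite S" and finC: "finite C"
    by (auto dest: finite_subset intro: finite_subset)
  obtain rs cs where rs: "distinct rs" "set rs = verts H"
    and cs: "distinct cs" "set cs = block_columns G B M H"
    and F_eq: "F = flow_matrix G c e rs cs"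
    using F by (auto simp: is_flow_block_def)
  let ?K = "Canonical_Arc ` S \<union> Balancing_Flow ` ?X"
  have "card ?K \<le> card (S \<union> C)"
  proof (rule full_rank_flow_matrix_card_support[OF rs(1) cs(1)])
    show "vec_space.rank (length rs) (flow_matrix G c e rs cs) = length cs"
      using rank by (simp add: F_eq flow_matrix_def)
    show "S \<union> C \<subseteq> set rs"
      using S CH rs by auto
    show "?K \<subseteq> set cs"
      using S SY sub by (auto simp: cs block_columns_def flow_columns_def)
    fix u k assume k: "k \<in> ?K" and nz: "flow_entry G c e u k \<noteq> 0"
    from k show "u \<in> S \<union> C"
    proof
      assume "k \<in> Canonical_Arc ` S"
      then obtain v where v: "v \<in> S" "k = Canonical_Arc v"
        by auto
      then have vH: "v \<in> verts H" "v \<notin> adj_monitored G M"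
        using S SY by auto
      \<comment> \<open>A canonical arc column is supported on its own vertex and the out-neighbours
        of that vertex.\<close>
      from nz v consider "u = v" | "(v, u) \<in> parcs G"
        by (auto split: if_splits)
      then show ?thesis
      proof cases
        case 2
        \<comment> \<open>Either \<open>u\<close> is in \<open>C\<close>, or the walk to
          \<open>v\<close> extends along the arc to \<open>u\<close>.\<close>
        from unmonitored_component_arc_closed[OF H vH 2] v show ?thesis
          unfolding S_def using avoiding_reach_step by fastforce
      qed (use v in auto)
    next
      assume "k \<in> Balancing_Flow ` ?X"
      with nz have "u \<in> ?X"
        by (auto split: if_splits)
      \<comment> \<open>A source outside \<open>C\<close> is reached by its one-vertex walk.\<close>
      then show ?thesis
        unfolding S_def using avoiding_reach_source[of u ?X H C] by auto
    qed
  qed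
  moreover have "card ?K = card S + card ?X"
    using finS fin by (subst card_Un_disjoint) (auto simp: card_image inj_on_def)
  \<comment> \<open>\<open>S\<close> is disjoint from \<open>C\<close>, so \<open>card S\<close>
    cancels exactly against the canonical arc columns.\<close>
  moreover have "card (S \<union> C) = card S + card C"
    using finS finC S by (intro card_Un_disjoint) auto
  ultimately show ?thesis
    by simp
qed

end

theorem theorem5p2:
  fixes G :: "'a pair_pre_digraph"
    and B M C :: "'a set"
    and c :: "'a \<times> 'a \<Rightarrow> real"
    and e :: "'a \<Rightarrow> 'a \<times> 'a"
    and H :: "('a, 'a \<times> 'a) pre_digraph"
    and F :: "real mat"
  assumes "flow_network G B M c e"
    and "unmonitored_component G M H"
    and "is_flow_block G B M c e H F"
    and "minimum_vertex_cut H (verts H \<inter> (B - M)) (verts H \<inter> adj_monitored G M) C"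
    and "vec_space.rank (dim_row F) F = dim_col F"
  shows "card C = card (verts H \<inter> (B - M))"
proof (rule antisym)
  let ?X = "verts H \<inter> (B - M)" and ?Y = "verts H \<inter> adj_monitored G M"
  have cut: "vertex_cut H ?X ?Y C"
    and min: "\<And>D. vertex_cut H ?X ?Y D \<Longrightarrow> card C \<le> card D"
    using assms(4) by (auto simp: minimum_vertex_cut_def is_arg_min_linorder)
  \<comment> \<open>If there are no sources, this already forces \<open>card C = 0\<close>.\<close>
  show "card C \<le> card ?X"
    by (rule min[OF vertex_cut_source]) auto
  show "card ?X \<le> card C"
    by (rule flow_network.card_sources_le_card_vertex_cut[OF assms(1,2,3,5) cut])
qed

end
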